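(* Let $\mathcal T$ be the rooted labelled tree whose root (at level $0$) has label $(1)$, and in which every node with label $(s)$ at level $n$ has, for each $j\in\{1,\dots,s\}$: exactly $s+1-j$ children labelled $(j)$ at level $n+1$, exactly $s+1-j$ children labelled $(j+1)$ at level $n+2$, and exactly $\binom{s+1-j}{2}$ children labelled $(j)$ at level $n+2$ (and no other children). Then for every $n\geqslant 0$, the number of nodes of $\mathcal T$ at level $n$ equals $|\mathcal{I}_n(000,102)|$.
   Context: For $n\in\mathbb N$, an inversion sequence of size $n$ is a sequence $\sigma=(\sigma_1,\dots,\sigma_n)\in\mathbb N^n$ with $\sigma_i<i$ for all $i$. An integer sequence contains a pattern $\rho$ (a finite integer sequence such as $000$ or $102$) if it has a subsequence order-isomorphic to $\rho$, and avoids $\rho$ otherwise. $\mathcal{I}_n(P)$ denotes the set of inversion sequences of size $n$ avoiding every pattern in the set $P$. *)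

theory Defs
  imports Complex_Main "HOL-Library.Sublist"
begin

text \<open>
  Sequences are lists, indexed from 0: the entry \<open>\<sigma>\<^sub>i\<close> of the usual 1-indexed
  notation is \<open>\<sigma> ! (i - 1)\<close>, so \<open>\<sigma>\<^sub>i < i\<close> becomes \<open>\<sigma> ! k < Suc k\<close>.
\<close>

definition inversion_seq :: "nat \<Rightarrow> nat list \<Rightarrow> bool" where
  "inversion_seq n \<sigma> \<longleftrightarrow> length \<sigma> = n \<and> (\<forall>k<n. \<sigma> ! k < Suc k)"

definition order_isomorphic :: "'a::linorder list \<Rightarrow> 'b::linorder list \<Rightarrow> bool" where
  "order_isomorphic xs ys \<longleftrightarrow> length xs = length ys \<and>
     (\<forall>i<length xs. \<forall>j<length xs. xs ! i < xs ! j \<longleftrightarrow> ys ! i < ys ! j)"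

definition contains_pattern :: "'a::linorder list \<Rightarrow> 'b::linorder list \<Rightarrow> bool" where
  "contains_pattern \<sigma> \<rho> \<longleftrightarrow> (\<exists>\<tau>. subseq \<tau> \<sigma> \<and> order_isomorphic \<tau> \<rho>)"

definition avoiding_inversion_seqs :: "nat \<Rightarrow> nat list set \<Rightarrow> nat list set" where
  "avoiding_inversion_seqs n P =
     {\<sigma>. inversion_seq n \<sigma> \<and> (\<forall>\<rho>\<in>P. \<not> contains_pattern \<sigma> \<rho>)}"

text \<open>
  A node of the tree is the list of edges leading from it up to the root (most recent
  edge first).  An edge records the clause of the succession rule producing the
  child, the parameter \<open>j\<close> of that clause, and an index \<open>i\<close> that tells apart the several
  children produced by the same clause with the same \<open>j\<close>.
  Starting from a parent at level \<open>n\<close>, \<open>Step1 j i\<close> leads to label \<open>(j)\<close> at level \<open>n + 1\<close>,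
  \<open>Step2_up j i\<close> to label \<open>(j + 1)\<close> at level \<open>n + 2\<close>, and \<open>Step2 j i\<close> to label \<open>(j)\<close> at
  level \<open>n + 2\<close>.
\<close>

datatype edge = Step1 nat nat | Step2_up nat nat | Step2 nat nat

fun node_label :: "edge list \<Rightarrow> nat" where
  "node_label [] = 1"
| "node_label (Step1 j i # p) = j"
| "node_label (Step2_up j i # p) = j + 1"
| "node_label (Step2 j i # p) = j"

fun node_level :: "edge list \<Rightarrow> nat" where
  "node_level [] = 0"
| "node_level (Step1 j i # p) = node_level p + 1"
| "node_level (Step2_up j i # p) = node_level p + 2"
| "node_level (Step2 j i # p) = node_level p + 2"

definition child_edges :: "nat \<Rightarrow> edge set" where
  "child_edges s =
     {Step1 j i | j i. j \<in> {1..s} \<and> i < s + 1 - j} \<union>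
     {Step2_up j i | j i. j \<in> {1..s} \<and> i < s + 1 - j} \<union>
     {Step2 j i | j i. j \<in> {1..s} \<and> i < (s + 1 - j) choose 2}"

inductive_set tree_nodes :: "edge list set" where
  root: "[] \<in> tree_nodes"
| child: "p \<in> tree_nodes \<Longrightarrow> e \<in> child_edges (node_label p) \<Longrightarrow> e # p \<in> tree_nodes"

definition nodes_at_level :: "nat \<Rightarrow> edge list set" where
  "nodes_at_level n = {p \<in> tree_nodes. node_level p = n}"

end

theory Submission imports Defs "HOL-Library.Nat_Bijection"
begin

text \<open>
  Every nonempty avoider arises uniquely from a smaller one by inserting one or two copies
  of a new maximum \<open>m\<close>. Avoiding \<open>102\<close> means that the smaller entries before the last copy are
  sorted, and the bound \<open>\<sigma>\<^sub>i < i\<close> means that at least \<open>m\<close> entries precede the first copy. If \<open>L\<close> is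
  the length of the longest sorted prefix and \<open>M\<close> the least strict upper bound of the entries,
  the number \<open>L + 1 - M\<close> is the label in the tree: for \<open>m = M + a\<close>, with \<open>M + a + c\<close> entries before
  the first copy and \<open>d\<close> entries between the copies, an insertion is legal iff
  \<open>a + c + d < L + 1 - M\<close>. The new label is \<open>c + 1\<close>, except when two adjacent copies are inserted,
  where it is \<open>c + 2\<close>. These are the three clauses of the succession rule with \<open>j = c + 1\<close>;
  pairs \<open>(a, d - 1)\<close> with bounded sum are enumerated by the Cantor pairing function.
\<close>

section \<open>Least strict upper bound and longest sorted prefix\<close>

fun strict_bound :: "nat list \<Rightarrow> nat" where
  "strict_bound [] = 0"
| "strict_bound (x # xs) = max (Suc x) (strict_bound xs)"

lemma strict_bound_le_iff: "strict_bound xs \<le> m \<longleftrightarrow> (\<forall>x\<in>set xs. x < m)"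
  by (induction xs) auto

lemma strict_bound_eq:
  assumes "m \<in> set xs" "\<forall>x\<in>set xs. x \<le> m"
  shows "strict_bound xs = Suc m"
  using assms strict_bound_le_iff[of xs "Suc m"] strict_bound_le_iff[of xs m]
  by (auto simp: less_Suc_eq_le)

fun ascent_length :: "'a::linorder list \<Rightarrow> nat" where
  "ascent_length [] = 0"
| "ascent_length [x] = 1"
| "ascent_length (x # y # ys) = (if x \<le> y then Suc (ascent_length (y # ys)) else 1)"

text \<open>Prefixes of sorted lists are sorted, so the lengths of sorted prefixes form an initial
  segment. Beyond the length, \<open>take k xs\<close> would be all of \<open>xs\<close>, hence the
  side condition.\<close>

lemma le_ascent_length_iff:
  "k \<le> length xs \<Longrightarrow> k \<le> ascent_length xs \<longleftrightarrow> sorted (take k xs)"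
proof (induction xs arbitrary: k rule: ascent_length.induct)
  case (3 x y ys)
  show ?case
  proof (cases k)
    case (Suc l)
    then show ?thesis using 3 by (cases l) (auto dest: order_trans)
  qed simp
qed (auto simp: take_Cons')

lemma ascent_length_le: "ascent_length xs \<le> length xs"
  by (induction xs rule: ascent_length.induct) auto

text \<open>The descent after \<open>y\<close>, or the end of the list, stops the sorted prefix
  exactly at \<open>y\<close>. It is applied with \<open>y\<close> a newly inserted maximum.\<close>

lemma ascent_length_peak:
  assumes "sorted (xs @ [y])" "ys \<noteq> [] \<Longrightarrow> hd ys < y"
  shows "ascent_length (xs @ y # ys) = Suc (length xs)"
proof (rule antisym)
  show "Suc (length xs) \<le> ascent_length (xs @ y # ys)"
    using assms(1) by (subst le_ascent_length_iff) auto
  show "ascent_length (xs @ y # ys) \<le> Suc (length xs)"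
  proof (cases ys)
    case Nil
    then show ?thesis using ascent_length_le[of "xs @ y # ys"] by simp
  next
    case (Cons z zs)
    then have "\<not> sorted (take (Suc (Suc (length xs))) (xs @ y # ys))"
      using assms(2) by (auto simp: sorted_append)
    then show ?thesis
      using Cons le_ascent_length_iff[of "Suc (Suc (length xs))" "xs @ y # ys"] by auto
  qed
qed

section \<open>Effect of inserting a maximum on the index bound and on the patterns\<close>

definition bounded_by_index :: "nat list \<Rightarrow> bool" where
  "bounded_by_index xs \<longleftrightarrow> (\<forall>k<length xs. xs ! k \<le> k)"

text \<open>Insertion moves \<open>ys\<close> to the right, which only relaxes its bounds. After
  deletion, the entries of \<open>ys\<close> stand at positions at least \<open>length xs\<close>,
  hence at least \<open>m\<close>, so they remain bounded.\<close>

lemma bounded_by_index_insert: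
  assumes "\<forall>y\<in>set ys. y \<le> m"
  shows "bounded_by_index (xs @ m # ys) \<longleftrightarrow> bounded_by_index (xs @ ys) \<and> m \<le> length xs"
proof safe
  assume b: "bounded_by_index (xs @ m # ys)"
  show m: "m \<le> length xs"
    using b[unfolded bounded_by_index_def, rule_format, of "length xs"] by simp
  show "bounded_by_index (xs @ ys)"
    unfolding bounded_by_index_def
  proof (intro allI impI)
    fix k assume k: "k < length (xs @ ys)"
    show "(xs @ ys) ! k \<le> k"
    proof (cases "k < length xs")
      case True
      then show ?thesis
        using b[unfolded bounded_by_index_def, rule_format, of k] by (simp add: nth_append)
    next
      case False
      then have "ys ! (k - length xs) \<in> set ys" using k by simp
      then show ?thesis using assms m False by (fastforce simp: nth_append)
    qed
  qed
next
  assume b: "bounded_by_index (xs @ ys)" and m: "m \<le> length xs"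
  show "bounded_by_index (xs @ m # ys)"
    unfolding bounded_by_index_def
  proof (intro allI impI)
    fix k assume k: "k < length (xs @ m # ys)"
    consider "k < length xs" | "k = length xs" | l where "k = Suc l" "length xs \<le> l"
      by (metis less_Suc_eq_le not_less_eq less_imp_Suc_add linorder_neqE_nat le_add1)
    then show "(xs @ m # ys) ! k \<le> k"
    proof cases
      case 1
      then show ?thesis
        using b[unfolded bounded_by_index_def, rule_format, of k] by (simp add: nth_append)
    next
      case 3
      then show ?thesis
        using b[unfolded bounded_by_index_def, rule_format, of l] k
        by (simp add: nth_append Suc_diff_le)
    qed (use m in simp)
  qed
qed

definition avoids_102 :: "'a::linorder list \<Rightarrow> bool" where
  "avoids_102 xs \<longleftrightarrow> (\<forall>a b c. a < b \<longrightarrow> b < c \<longrightarrow> \<not> subseq [b, a, c] xs)"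

text \<open>Sortedness as avoidance of the pattern 10, the part of 102 that remains once its largest
  letter is matched.\<close>

lemma sorted_iff_subseq:
  "sorted xs \<longleftrightarrow> (\<forall>a b. a < b \<longrightarrow> \<not> subseq [b, a] (xs :: 'a::linorder list))"
proof (induction xs)
  case (Cons x xs)
  have "subseq [b, a] (x # xs) \<longleftrightarrow> subseq [b, a] xs \<or> b = x \<and> a \<in> set xs" for a b
    by (auto simp: subseq_singleton_left dest: subseq_Cons')
  then show ?case using Cons by (simp add: not_less del: subseq_Cons2_iff) (metis not_less)
qed auto

lemma set_mono_subseq: "subseq xs ys \<Longrightarrow> set xs \<subseteq> set ys"
  by (induction rule: list_emb.induct) auto

text \<open>The displayed \<open>m\<close> is the last one in the host, so the final letter may be
  matched there, and the rest must embed before it.\<close>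

lemma subseq_snoc_iff:
  "m \<notin> set zs \<Longrightarrow> subseq (ws @ [m]) (us @ m # zs) \<longleftrightarrow> subseq ws us"
proof
  assume m: "m \<notin> set zs" and "subseq (ws @ [m]) (us @ m # zs)"
  then obtain vs vs' where v: "ws @ [m] = vs @ vs'" "subseq vs us" "subseq vs' (m # zs)"
    by (auto simp: subseq_append_iff)
  show "subseq ws us"
  proof (cases vs' rule: rev_cases)
    case Nil
    then show ?thesis using v by (metis append_Nil2 prefix_imp_subseq prefixI subseq_order.order_trans)
  next
    case (snoc ts t)
    then have t: "vs' = ts @ [m]" "ws = vs @ ts" using v(1) by auto
    \<comment> \<open>Otherwise a letter of \<open>ts\<close> would precede the final
      \<open>m\<close> inside \<open>m # zs\<close>, pushing that \<open>m\<close> into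
      \<open>zs\<close>.\<close>
    have "ts = []"
    proof (cases ts)
      case (Cons r rs)
      then have "subseq (rs @ [m]) zs \<or> subseq (r # rs @ [m]) zs"
        using v(3) t(1) by (auto split: if_splits)
      then have "m \<in> set zs" by (auto dest!: set_mono_subseq)
      then show ?thesis using m by simp
    qed
    then show ?thesis using t v by simp
  qed
next
  assume "subseq ws us"
  then show "subseq (ws @ [m]) (us @ m # zs)"
    by (intro list_emb_append_mono) auto
qed

lemma subseq_remove:
  assumes "m \<notin> set ws"
  shows "subseq ws xs \<longleftrightarrow> subseq ws (filter (\<lambda>x. x \<noteq> m) xs)"
proof
  have "filter (\<lambda>x. x \<noteq> m) ws = ws" using assms by (auto simp: filter_id_conv)
  then show "subseq ws xs \<Longrightarrow> subseq ws (filter (\<lambda>x. x \<noteq> m) xs)"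
    by (metis subseq_filter)
  show "subseq ws (filter (\<lambda>x. x \<noteq> m) xs) \<Longrightarrow> subseq ws xs"
    by (metis subseq_filter_left subseq_order.order_trans)
qed

text \<open>In an occurrence of 102 the maximum can only play the 2, and it may be taken to be the
  last copy, so what precedes it must contain no descent of smaller entries. Filtering out
  \<open>m\<close> lets \<open>us\<close> contain further copies, so the lemma serves both one and
  two insertions.\<close>

lemma avoids_102_max:
  assumes "\<forall>x\<in>set (us @ m # zs). x \<le> m" "m \<notin> set zs"
  shows "avoids_102 (us @ m # zs) \<longleftrightarrow>
    avoids_102 (filter (\<lambda>x. x \<noteq> m) (us @ zs)) \<and> sorted (filter (\<lambda>x. x \<noteq> m) us)"
proof -
  have *: "subseq [b, a, c] (us @ m # zs) \<longleftrightarrow>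
      subseq [b, a, c] (filter (\<lambda>x. x \<noteq> m) (us @ zs)) \<or>
      c = m \<and> subseq [b, a] (filter (\<lambda>x. x \<noteq> m) us)" if "a < b" "b < c" for a b c
  proof (cases "c = m")
    case True
    have "\<not> subseq [b, a, c] (filter (\<lambda>x. x \<noteq> m) (us @ zs))"
      using True by (auto dest!: set_mono_subseq)
    then show ?thesis
      using True subseq_snoc_iff[OF assms(2), of "[b, a]" us]
        subseq_remove[of m "[b, a]" us] less_trans[OF that] that by fastforce
  next
    case False
    show ?thesis
    proof (cases "c < m")
      case True
      then have "m \<noteq> a" "m \<noteq> b" using that by auto
      then show ?thesis using True subseq_remove[of m "[b, a, c]" "us @ m # zs"] by auto
    next
      case nless: False
      then have "c \<notin> set (us @ m # zs)" using assms(1) False by fastforce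
      then have "\<not> subseq [b, a, c] (us @ m # zs)" "\<not> subseq [b, a, c] (filter (\<lambda>x. x \<noteq> m) (us @ zs))"
        by (auto dest!: set_mono_subseq)
      then show ?thesis using False by simp
    qed
  qed
  \<comment> \<open>Every descent left after filtering lies below \<open>m\<close>, so
    \<open>m\<close> completes it to a 102.\<close>
  have "a < b \<Longrightarrow> subseq [b, a] (filter (\<lambda>x. x \<noteq> m) us) \<Longrightarrow> b < m" for a b
    using assms(1) set_mono_subseq[of "[b, a]" "filter (\<lambda>x. x \<noteq> m) us"]
    by (auto simp: order.order_iff_strict)
  then show ?thesis
    unfolding avoids_102_def sorted_iff_subseq using * by blast
qed

definition avoider :: "nat list \<Rightarrow> bool" where
  "avoider xs \<longleftrightarrow> bounded_by_index xs \<and> (\<forall>v. count_list xs v \<le> 2) \<and> avoids_102 xs"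

lemma avoider_insert_one:
  assumes "\<forall>x\<in>set (xs @ ys). x < m"
  shows "avoider (xs @ m # ys) \<longleftrightarrow> avoider (xs @ ys) \<and> m \<le> length xs \<and> sorted xs"
proof -
  have "m \<notin> set xs" "m \<notin> set ys" using assms by auto
  then have [simp]: "filter (\<lambda>x. x \<noteq> m) xs = xs" "filter (\<lambda>x. x \<noteq> m) ys = ys"
    "count_list xs m = 0" "count_list ys m = 0"
    by (auto simp: filter_id_conv count_list_0_iff)
  have "count_list (xs @ m # ys) v \<le> 2 \<longleftrightarrow> count_list (xs @ ys) v \<le> 2" for v
    by (cases "v = m") auto
  moreover have "\<forall>x\<in>set (xs @ ys). x \<le> m" using assms less_imp_le by blast
  ultimately show ?thesis
    unfolding avoider_def
    using bounded_by_index_insert[of ys m xs] avoids_102_max[of xs m ys] \<open>m \<notin> set ys\<close>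
    by auto
qed

lemma avoider_insert_two:
  assumes "\<forall>x\<in>set (xs @ ys @ zs). x < m"
  shows "avoider (xs @ m # ys @ m # zs) \<longleftrightarrow>
    avoider (xs @ ys @ zs) \<and> m \<le> length xs \<and> sorted (xs @ ys)"
proof -
  have "m \<notin> set xs" "m \<notin> set ys" "m \<notin> set zs" using assms by auto
  then have [simp]: "filter (\<lambda>x. x \<noteq> m) xs = xs" "filter (\<lambda>x. x \<noteq> m) ys = ys"
     "filter (\<lambda>x. x \<noteq> m) zs = zs"
    "count_list xs m = 0" "count_list ys m = 0" "count_list zs m = 0"
    by (auto simp: filter_id_conv count_list_0_iff)
  have "count_list (xs @ m # ys @ m # zs) v \<le> 2 \<longleftrightarrow> count_list (xs @ ys @ zs) v \<le> 2" for v
    by (cases "v = m") auto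
  moreover have le: "\<forall>x\<in>set (xs @ ys @ zs). x \<le> m" using assms less_imp_le by blast
  \<comment> \<open>Strip the second copy, then the first. The bound for the second copy follows
    from that for the first.\<close>
  moreover have "bounded_by_index (xs @ m # ys @ m # zs) \<longleftrightarrow> bounded_by_index (xs @ ys @ zs) \<and> m \<le> length xs"
    using le bounded_by_index_insert[of zs m "xs @ m # ys"] bounded_by_index_insert[of "ys @ zs" m xs]
    by auto
  moreover have "avoids_102 (xs @ m # ys @ m # zs) \<longleftrightarrow> avoids_102 (xs @ ys @ zs) \<and> sorted (xs @ ys)"
    using le avoids_102_max[of "xs @ m # ys" m zs] \<open>m \<notin> set zs\<close> by auto
  ultimately show ?thesis
    unfolding avoider_def by auto
qed

section \<open>Translation between the patterns and the conditions in \<open>avoider\<close>\<close>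

lemma count_list_le_2_iff: "count_list xs v \<le> 2 \<longleftrightarrow> \<not> subseq [v, v, v] xs"
proof -
  \<comment> \<open>Generalised from 3 to all \<open>n\<close>, since matching the head of the list
    uses up one copy.\<close>
  have "n \<le> count_list xs v \<longleftrightarrow> subseq (replicate n v) xs" for n
  proof (induction xs arbitrary: n)
    case (Cons x xs)
    then show ?case by (cases n) auto
    next
    case Nil
    show ?case by (cases n) auto
  qed
  from this[of 3] show ?thesis by (simp add: numeral_3_eq_3 numeral_2_eq_2) (meson not_less_eq_eq)
qed

lemma contains_pattern_000_iff:
  "contains_pattern xs [0, 0, 0 :: nat] \<longleftrightarrow> (\<exists>v. subseq [v, v, v] xs)"
proof
  assume "contains_pattern xs [0, 0, 0 :: nat]"
  then obtain ts where "subseq ts xs" and o: "order_isomorphic ts [0, 0, 0 :: nat]"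
    by (auto simp: contains_pattern_def)
  from o obtain u v w where "ts = [u, v, w]"
    by (auto simp: order_isomorphic_def length_Suc_conv)
  moreover from this have "u = v" "v = w"
    using o by (auto simp: order_isomorphic_def All_less_Suc)
  ultimately show "\<exists>v. subseq [v, v, v] xs" using \<open>subseq ts xs\<close> by blast
next
  assume "\<exists>v. subseq [v, v, v] xs"
  then obtain v where "subseq [v, v, v] xs" by blast
  moreover have "order_isomorphic [v, v, v] [0, 0, 0 :: nat]"
    by (auto simp: order_isomorphic_def All_less_Suc)
  ultimately show "contains_pattern xs [0, 0, 0 :: nat]"
    by (auto simp: contains_pattern_def)
qed

lemma contains_pattern_102_iff:
  "contains_pattern xs [1, 0, 2 :: nat] \<longleftrightarrow> (\<exists>a b c. a < b \<and> b < c \<and> subseq [b, a, c] xs)"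
proof
  assume "contains_pattern xs [1, 0, 2 :: nat]"
  then obtain ts where "subseq ts xs" and o: "order_isomorphic ts [1, 0, 2 :: nat]"
    by (auto simp: contains_pattern_def)
  from o obtain b a c where "ts = [b, a, c]"
    by (auto simp: order_isomorphic_def length_Suc_conv)
  moreover from this have "a < b" "b < c"
    using o by (auto simp: order_isomorphic_def All_less_Suc)
  ultimately show "\<exists>a b c. a < b \<and> b < c \<and> subseq [b, a, c] xs" using \<open>subseq ts xs\<close> by blast
next
  assume "\<exists>a b c. a < b \<and> b < c \<and> subseq [b, a, c] xs"
  then obtain a b c where "a < b" "b < c" "subseq [b, a, c] xs" by blast
  moreover from this have "order_isomorphic [b, a, c] [1, 0, 2 :: nat]"
    by (auto simp: order_isomorphic_def All_less_Suc)
  ultimately show "contains_pattern xs [1, 0, 2 :: nat]"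
    by (auto simp: contains_pattern_def)
qed

lemma avoiding_inversion_seqs_000_102:
  "avoiding_inversion_seqs n {[0, 0, 0], [1, 0, 2]} = {xs. avoider xs \<and> length xs = n}"
  by (auto simp: avoiding_inversion_seqs_def avoider_def inversion_seq_def bounded_by_index_def
      contains_pattern_000_iff contains_pattern_102_iff avoids_102_def count_list_le_2_iff
      less_Suc_eq_le simp del: One_nat_def)

section \<open>Legal insertions: their effect, injectivity and exhaustiveness\<close>

fun gap :: "nat option \<Rightarrow> nat" where
  "gap None = 0"
| "gap (Some d) = d"

text \<open>The third component is \<open>None\<close> for a single copy and \<open>Some d\<close>
  for two copies with \<open>d\<close> entries between them.\<close>

fun insert_max :: "nat list \<Rightarrow> nat \<times> nat \<times> nat option \<Rightarrow> nat list" where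
  "insert_max xs (a, c, None) = (let m = strict_bound xs + a in
     take (m + c) xs @ m # drop (m + c) xs)"
| "insert_max xs (a, c, Some d) = (let m = strict_bound xs + a in
     take (m + c) xs @ m # take d (drop (m + c) xs) @ m # drop (m + c + d) xs)"

text \<open>This becomes the node label. Where the subtraction truncates, the value is 0 and
  \<open>insertions\<close> is empty.\<close>

definition slack :: "nat list \<Rightarrow> nat" where
  "slack xs = Suc (ascent_length xs) - strict_bound xs"

definition insertions :: "nat \<Rightarrow> (nat \<times> nat \<times> nat option) set" where
  "insertions s = {(a, c, t). a + c + gap t < s}"

text \<open>Legality places the last cut inside the sorted prefix, so every \<open>take\<close> and
  \<open>drop\<close> has its nominal length and the entries before the last copy are
  sorted.\<close>

lemma insertE:
  assumes "x \<in> insertions (slack xs)"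
  obtains (one) a c m us vs where "x = (a, c, None)" "xs = us @ vs" "insert_max xs x = us @ m # vs"
      "sorted us" "\<forall>x\<in>set xs. x < m" "m = strict_bound xs + a" "length us = m + c"
      "ascent_length xs \<ge> length us"
    | (two) a c d m us vs ws where "x = (a, c, Some d)" "xs = us @ vs @ ws"
      "insert_max xs x = us @ m # vs @ m # ws"
      "sorted (us @ vs)" "\<forall>x\<in>set xs. x < m" "m = strict_bound xs + a" "length us = m + c"
      "length vs = d" "ascent_length xs \<ge> length (us @ vs)"
proof -
  obtain a c t where x: "x = (a, c, t)" by (cases x)
  define m where "m = strict_bound xs + a"
  \<comment> \<open>The \<open>Suc\<close> in \<open>slack\<close> turns the strict inequality of
    \<open>insertions\<close> into a weak one.\<close>
  have l: "m + c + gap t \<le> ascent_length xs"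
    using assms by (auto simp: x m_def insertions_def slack_def)
  have m: "\<forall>x\<in>set xs. x < m" using strict_bound_le_iff[of xs m] by (simp add: m_def)
  note len = ascent_length_le[of xs]
  have s: "sorted (take (m + c + gap t) xs)"
    using l len le_ascent_length_iff[of "m + c + gap t" xs] by linarith
  show ?thesis
  proof (cases t)
    case None
    show ?thesis
      by (rule one[of a c "take (m + c) xs" "drop (m + c) xs" m])
        (use None x l m s len in \<open>auto simp: m_def Let_def\<close>)
  next
    case (Some d)
    have "xs = take (m + c) xs @ take d (drop (m + c) xs) @ drop (m + c + d) xs"
      by (metis append_assoc append_take_drop_id take_add)
    moreover have "sorted (take (m + c) xs @ take d (drop (m + c) xs))"
      using s Some by (simp add: take_add)
    moreover have "length (take (m + c) xs) = m + c" "length (take d (drop (m + c) xs)) = d"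
      using l len Some by auto
    ultimately show ?thesis
      using Some x l m
      by (intro two[of a c d "take (m + c) xs" "take d (drop (m + c) xs)" "drop (m + c + d) xs" m])
        (simp_all add: m_def Let_def)
  qed
qed

lemma strict_bound_insert_max:
  assumes "x \<in> insertions (slack xs)"
  shows "strict_bound (insert_max xs x) = Suc (strict_bound xs + fst x)"
  using assms
proof (cases rule: insertE)
  case (one a c m us vs)
  then have "strict_bound (us @ m # vs) = Suc m"
    by (intro strict_bound_eq) (auto intro: less_imp_le)
  then show ?thesis using one(1,3,6) by simp
next
  case (two a c d m us vs ws)
  then have "strict_bound (us @ m # vs @ m # ws) = Suc m"
    by (intro strict_bound_eq) (auto intro: less_imp_le)
  then show ?thesis using two(1,3,6) by simp
qed

text \<open>The sorted prefix ends at the first copy of the new maximum, unless the second copy is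
  adjacent and extends it by one.\<close>

lemma ascent_length_insert_max:
  assumes "x \<in> insertions (slack xs)"
  shows "ascent_length (insert_max xs x) =
    strict_bound xs + fst x + fst (snd x) + (if snd (snd x) = Some 0 then 2 else 1)"
  using assms
proof (cases rule: insertE)
  case (one a c m us vs)
  then have "sorted (us @ [m])" "vs \<noteq> [] \<Longrightarrow> hd vs < m"
    by (auto simp: sorted_append intro: less_imp_le)
  then show ?thesis using ascent_length_peak[of us m vs] one(1,3,6,7) by simp
next
  case (two a c d m us vs ws)
  then have s: "sorted (us @ [m])" "sorted ((us @ [m]) @ [m])"
    and hd: "vs \<noteq> [] \<Longrightarrow> hd vs < m" "ws \<noteq> [] \<Longrightarrow> hd ws < m"
    by (auto simp: sorted_append intro: less_imp_le)
  show ?thesis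
  proof (cases d)
    case 0
    then show ?thesis
      using ascent_length_peak[OF s(2) hd(2)] two(1,3,6,7,8) by simp
  next
    case (Suc d')
    then have "vs \<noteq> []" using two(8) by auto
    then show ?thesis
      using ascent_length_peak[OF s(1), of "vs @ m # ws"] hd(1) two(1,3,6,7) Suc by simp
  qed
qed

text \<open>The new maximum cancels between prefix length and strict bound, so neither
  \<open>a\<close> nor a positive \<open>d\<close> affects the new label.\<close>

lemma slack_insert_max:
  "x \<in> insertions (slack xs) \<Longrightarrow>
    slack (insert_max xs x) = fst (snd x) + (if snd (snd x) = Some 0 then 2 else 1)"
  by (simp add: slack_def[of "insert_max xs x"] strict_bound_insert_max ascent_length_insert_max)

lemma length_insert_max:
  "x \<in> insertions (slack xs) \<Longrightarrow>
    length (insert_max xs x) = length xs + (if snd (snd x) = None then 1 else 2)"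
  by (erule insertE) auto

lemma avoider_insert_max:
  "x \<in> insertions (slack xs) \<Longrightarrow> avoider xs \<Longrightarrow> avoider (insert_max xs x)"
  by (erule insertE) (simp_all add: avoider_insert_one avoider_insert_two)

lemma first_occurrence_unique:
  assumes "us @ m # vs = us' @ m # vs'" "m \<notin> set us" "m \<notin> set us'"
  shows "us = us'" "vs = vs'"
proof -
  have "takeWhile (\<lambda>x. x \<noteq> m) (us @ m # vs) = us" "takeWhile (\<lambda>x. x \<noteq> m) (us' @ m # vs') = us'"
    using assms(2,3) by (auto simp: takeWhile_append)
  then show "us = us'" using assms(1) by simp
  then show "vs = vs'" using assms(1) by simp
qed

text \<open>The strict bound of the result reveals the inserted value, and the positions of its
  copies reveal the remaining parameters and the original list.\<close>

lemma insert_max_inject: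
  assumes x: "x \<in> insertions (slack xs)" and y: "y \<in> insertions (slack ys)"
    and eq: "insert_max xs x = insert_max ys y"
  shows "xs = ys \<and> x = y"
proof -
  have m: "strict_bound xs + fst x = strict_bound ys + fst y"
    using strict_bound_insert_max[OF x] strict_bound_insert_max[OF y] eq by simp
  from x show ?thesis
  proof (cases rule: insertE)
    case X: (one a c m us vs)
    have nX: "m \<notin> set us" using X(2,5) by auto
    from y show ?thesis
    proof (cases rule: insertE)
      case Y: (one a' c' m' us' vs')
      have "m' = m" using m X(1,6) Y(1,6) by simp
      then have "us @ m # vs = us' @ m # vs'" "m \<notin> set us'"
        using X(3) Y(2,3,5) eq by auto
      from first_occurrence_unique[OF this(1) nX this(2)]
      have "us = us'" "xs = ys" using X(2) Y(2) by auto
      then show ?thesis using X(1,6,7) Y(1,6,7) \<open>m' = m\<close> by simp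
    next
      case Y: (two a' c' d' m' us' vs' ws')
      have "m' = m" using m X(1,6) Y(1,6) by simp
      then have "us @ m # vs = us' @ m # vs' @ m # ws'" "m \<notin> set us'"
        using X(3) Y(2,3,5) eq by auto
      from first_occurrence_unique(2)[OF this(1) nX this(2)]
      \<comment> \<open>With one copy on the left and two on the right, the extra copy would be an
        old entry, yet \<open>m\<close> exceeds all of those.\<close>
      have "m \<in> set xs" using X(2) by simp
      then show ?thesis using X(5) by blast
    qed
  next
    case X: (two a c d m us vs ws)
    have nX: "m \<notin> set us" "m \<notin> set vs" using X(2,5) by auto
    from y show ?thesis
    proof (cases rule: insertE)
      case Y: (one a' c' m' us' vs')
      have "m' = m" using m X(1,6) Y(1,6) by simp
      then have "us @ m # vs @ m # ws = us' @ m # vs'" "m \<notin> set us'"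
        using X(3) Y(2,3,5) eq by auto
      from first_occurrence_unique(2)[OF this(1) nX(1) this(2)]
      have "m' \<in> set ys" using Y(2) \<open>m' = m\<close> by auto
      then show ?thesis using Y(5) by blast
    next
      case Y: (two a' c' d' m' us' vs' ws')
      have "m' = m" using m X(1,6) Y(1,6) by simp
      then have e: "us @ m # vs @ m # ws = us' @ m # vs' @ m # ws'" "m \<notin> set us'" "m \<notin> set vs'"
        using X(3) Y(2,3,5) eq by auto
      note us = first_occurrence_unique[OF e(1) nX(1) e(2)]
      note vs = first_occurrence_unique[OF us(2) nX(2) e(3)]
      have "xs = ys" using X(2) Y(2) us(1) vs by simp
      then show ?thesis using X(1,6,7,8) Y(1,6,7,8) us(1) vs(1) \<open>m' = m\<close> by simp
    qed
  qed
qed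

text \<open>Delete all copies of the maximum; avoiding 000 leaves only one or two to delete.\<close>

lemma insert_max_exists:
  assumes "avoider ys" "ys \<noteq> []"
  obtains xs x where "avoider xs" "x \<in> insertions (slack xs)" "ys = insert_max xs x"
proof -
  define m where "m = Max (set ys)"
  have max: "\<forall>x\<in>set ys. x \<le> m" by (simp add: m_def)
  have "m \<in> set ys" using assms(2) by (simp add: m_def)
  then obtain us r where ys: "ys = us @ m # r" "m \<notin> set us"
    by (meson split_list_first)
  show thesis
  proof (cases "m \<in> set r")
    case False
    then have less: "\<forall>x\<in>set (us @ r). x < m"
      using max ys by (auto simp: order.order_iff_strict)
    then have av: "avoider (us @ r)" "m \<le> length us" "sorted us"
      using assms(1) ys avoider_insert_one by auto
    have sb: "strict_bound (us @ r) \<le> m" using less strict_bound_le_iff by blast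
    have "length us \<le> ascent_length (us @ r)"
      using av(3) by (subst le_ascent_length_iff) auto
    \<comment> \<open>The parameters sum to \<open>length us - strict_bound (us @ r)\<close>, and
      \<open>us\<close> lies within the sorted prefix.\<close>
    then have "(m - strict_bound (us @ r), length us - m, None) \<in> insertions (slack (us @ r))"
      using sb av(2) by (auto simp: insertions_def slack_def)
    then show thesis
      using av sb ys by (intro that[of "us @ r"]) (auto simp: Let_def)
  next
    case True
    then obtain vs ws where r: "r = vs @ m # ws" "m \<notin> set vs"
      by (meson split_list_first)
    have "count_list ys m \<le> 2" using assms(1) by (auto simp: avoider_def)
    then have "m \<notin> set ws" using ys r by (auto simp: count_list_0_iff)
    then have less: "\<forall>x\<in>set (us @ vs @ ws). x < m"
      using max ys r by (auto simp: order.order_iff_strict)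
    then have av: "avoider (us @ vs @ ws)" "m \<le> length us" "sorted (us @ vs)"
      using assms(1) ys r avoider_insert_two by auto
    have sb: "strict_bound (us @ vs @ ws) \<le> m" using less strict_bound_le_iff by blast
    have "length (us @ vs) \<le> ascent_length (us @ vs @ ws)"
      using av(3) by (subst le_ascent_length_iff) auto
    then have "(m - strict_bound (us @ vs @ ws), length us - m, Some (length vs))
        \<in> insertions (slack (us @ vs @ ws))"
      using sb av(2) by (auto simp: insertions_def slack_def)
    then show thesis
      using av sb ys r
      by (intro that[of "us @ vs @ ws"]) (auto simp: Let_def)
  qed
qed

section \<open>Tree edges as codes of legal insertions\<close>

lemma triangle_mono: "m \<le> n \<Longrightarrow> triangle m \<le> triangle n"
  by (rule lift_Suc_mono_le[of triangle]) auto

text \<open>Cantor pairing runs through the diagonals in order, and \<open>triangle k\<close> pairs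
  lie on the first \<open>k\<close> of them. This is the source of the binomial coefficient in the
  rule.\<close>

lemma prod_encode_less_triangle_iff: "prod_encode (a, b) < triangle k \<longleftrightarrow> a + b < k"
proof
  assume "prod_encode (a, b) < triangle k"
  then show "a + b < k"
    using triangle_mono[of k "a + b"] by (force simp: prod_encode_def)
next
  assume "a + b < k"
  then show "prod_encode (a, b) < triangle k"
    using triangle_mono[of "Suc (a + b)" k] by (simp add: prod_encode_def)
qed

lemma triangle_eq_choose: "triangle n = Suc n choose 2"
  by (simp add: triangle_def choose_two mult.commute)

text \<open>The child index is \<open>a\<close> itself in the first two clauses. In the third it
  encodes \<open>(a, d - 1)\<close>, because \<open>d = 0\<close> belongs to
  \<open>Step2_up\<close>.\<close>

fun insertion_of_edge :: "edge \<Rightarrow> nat \<times> nat \<times> nat option" where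
  "insertion_of_edge (Step1 j i) = (i, j - 1, None)"
| "insertion_of_edge (Step2_up j i) = (i, j - 1, Some 0)"
| "insertion_of_edge (Step2 j i) = (case prod_decode i of (a, b) \<Rightarrow> (a, j - 1, Some (Suc b)))"

lemma bij_betw_insertion_of_edge: "bij_betw insertion_of_edge (child_edges s) (insertions s)"
proof (rule bij_betw_imageI)
  show "inj_on insertion_of_edge (child_edges s)"
  proof (rule inj_onI)
    fix e e' assume "e \<in> child_edges s" "e' \<in> child_edges s"
      "insertion_of_edge e = insertion_of_edge e'"
    moreover have "i = i'" if "fst (prod_decode i) = fst (prod_decode i')"
      "snd (prod_decode i) = snd (prod_decode i')" for i i'
      using that prod_eqI inj_prod_decode[of UNIV] by (metis injD)
    ultimately show "e = e'"
      by (cases e; cases e') (auto simp: child_edges_def case_prod_beta)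
  qed
  show "insertion_of_edge ` child_edges s = insertions s"
  proof (intro subset_antisym subsetI)
    fix x assume "x \<in> insertion_of_edge ` child_edges s"
    then obtain e where e: "e \<in> child_edges s" "x = insertion_of_edge e" by auto
    show "x \<in> insertions s"
    proof (cases e)
      case (Step2 j i)
      obtain a b where ab: "prod_decode i = (a, b)" by fastforce
      have "i < triangle (s - j)" "1 \<le> j" "j \<le> s"
        using e Step2 by (auto simp: child_edges_def triangle_eq_choose Suc_diff_le)
      \<comment> \<open>Equivalent to \<open>a + (j - 1) + Suc b < s\<close>, the legality condition
        for \<open>d = Suc b\<close>.\<close>
      then have "a + b < s - j"
        using ab by (metis prod_decode_inverse prod_encode_less_triangle_iff)
      then show ?thesis using e Step2 ab \<open>1 \<le> j\<close> by (simp add: insertions_def)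
    qed (use e in \<open>auto simp: child_edges_def insertions_def\<close>)
  next
    fix x assume "x \<in> insertions s"
    then obtain a c t where x: "x = (a, c, t)" and l: "a + c + gap t < s"
      by (auto simp: insertions_def)
    consider "t = None" | "t = Some 0" | b where "t = Some (Suc b)"
      by (metis not0_implies_Suc option.exhaust)
    then show "x \<in> insertion_of_edge ` child_edges s"
    proof cases
      case 1
      then show ?thesis
        using x l by (intro image_eqI[of _ _ "Step1 (Suc c) a"]) (auto simp: child_edges_def)
    next
      case 2
      then show ?thesis
        using x l by (intro image_eqI[of _ _ "Step2_up (Suc c) a"]) (auto simp: child_edges_def)
    next
      case 3
      then have "prod_encode (a, b) < triangle (s - Suc c)"
        using l by (subst prod_encode_less_triangle_iff) auto
      then have "prod_encode (a, b) < (s + 1 - Suc c) choose 2"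
        using 3 l by (simp add: triangle_eq_choose Suc_diff_Suc)
      then show ?thesis
        using x l 3
        by (intro image_eqI[of _ _ "Step2 (Suc c) (prod_encode (a, b))"]) (auto simp: child_edges_def)
    qed
  qed
qed

section \<open>The bijection between tree nodes and avoiders\<close>

fun seq_of_node :: "edge list \<Rightarrow> nat list" where
  "seq_of_node [] = []"
| "seq_of_node (e # p) = insert_max (seq_of_node p) (insertion_of_edge e)"

lemma node_label_Cons:
  "e \<in> child_edges s \<Longrightarrow> node_label (e # p) =
    fst (snd (insertion_of_edge e)) + (if snd (snd (insertion_of_edge e)) = Some 0 then 2 else 1)"
  by (cases e) (simp_all add: child_edges_def case_prod_beta)

lemma node_level_Cons:
  "node_level (e # p) = node_level p + (if snd (snd (insertion_of_edge e)) = None then 1 else 2)"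
  by (cases e) (simp_all add: case_prod_beta)

text \<open>Proved jointly: the equality of slack and label makes each child edge a legal insertion,
  on which the other invariants depend.\<close>

lemma seq_of_node_invariants:
  assumes "p \<in> tree_nodes"
  shows "avoider (seq_of_node p)" "length (seq_of_node p) = node_level p"
    "slack (seq_of_node p) = node_label p"
proof -
  have "avoider (seq_of_node p) \<and> length (seq_of_node p) = node_level p \<and>
      slack (seq_of_node p) = node_label p"
    using assms
  proof (induction rule: tree_nodes.induct)
    case root
    show ?case
      by (simp add: avoider_def bounded_by_index_def avoids_102_def slack_def)
  next
    case (child p e)
    then have i: "insertion_of_edge e \<in> insertions (slack (seq_of_node p))"
      using bij_betw_insertion_of_edge[THEN bij_betwE] by simp
    show ?case
      using child.IH avoider_insert_max[OF i] length_insert_max[OF i] slack_insert_max[OF i]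
        node_label_Cons[OF child.hyps(2)] node_level_Cons
      by simp
  qed
  then show "avoider (seq_of_node p)" "length (seq_of_node p) = node_level p"
    "slack (seq_of_node p) = node_label p" by auto
qed

lemma insertion_of_edge_mem:
  "p \<in> tree_nodes \<Longrightarrow> e \<in> child_edges (node_label p) \<Longrightarrow>
    insertion_of_edge e \<in> insertions (slack (seq_of_node p))"
  using bij_betw_insertion_of_edge[THEN bij_betwE] seq_of_node_invariants(3) by simp

text \<open>Insertions lengthen the list, so only the root yields the empty one; otherwise
  \<open>insert_max_inject\<close> peels off equal last edges.\<close>

lemma inj_on_seq_of_node: "inj_on seq_of_node tree_nodes"
proof (rule inj_onI)
  fix p q assume "p \<in> tree_nodes" "q \<in> tree_nodes" "seq_of_node p = seq_of_node q"
  then show "p = q"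
  proof (induction arbitrary: q rule: tree_nodes.induct)
    case root
    from root.prems(1) show ?case
    proof cases
      case (child q' e)
      then show ?thesis
        using length_insert_max[OF insertion_of_edge_mem[OF child(2,3)]] root.prems(2)
        by (auto split: if_splits)
    qed simp
  next
    case (child p e)
    note mem = insertion_of_edge_mem[OF child.hyps]
    from child.prems(1) show ?case
    proof cases
      case root
      then show ?thesis
        using length_insert_max[OF mem] child.prems(2) by (auto split: if_splits)
    next
      case (child q' e')
      note eq = insert_max_inject[OF mem insertion_of_edge_mem[OF child(2,3)]]
      have "seq_of_node p = seq_of_node q'" "insertion_of_edge e = insertion_of_edge e'"
        using eq child.prems(2) child(1) by auto
      moreover from this have "p = q'" using child.IH child(2) by blast
      moreover from calculation have "e = e'"
        using bij_betw_insertion_of_edge[THEN bij_betw_imp_inj_on, THEN inj_onD] child(3) child.hyps(2)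
        by blast
      ultimately show ?thesis using child(1) by simp
    qed
  qed
qed

text \<open>Removing the maximum shortens an avoider, so induction on length supplies the parent
  node.\<close>

lemma seq_of_node_surj:
  assumes "avoider xs"
  shows "xs \<in> seq_of_node ` tree_nodes"
  using assms
proof (induction xs rule: length_induct)
  case (1 xs)
  show ?case
  proof (cases "xs = []")
    case True
    then show ?thesis using tree_nodes.root by (metis image_eqI seq_of_node.simps(1))
  next
    case False
    then obtain ys x where y: "avoider ys" "x \<in> insertions (slack ys)" "xs = insert_max ys x"
      using 1 insert_max_exists by blast
    have "length ys < length xs" using length_insert_max[OF y(2)] y(3) by simp
    then obtain p where p: "p \<in> tree_nodes" "ys = seq_of_node p" using 1 y(1) by blast
    then have "x \<in> insertions (node_label p)" using y(2) seq_of_node_invariants(3) by simp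
    then obtain e where "e \<in> child_edges (node_label p)" "x = insertion_of_edge e"
      using bij_betw_insertion_of_edge[THEN bij_betw_imp_surj_on] by (metis imageE)
    then show ?thesis
      using p y(3) by (intro image_eqI[of _ _ "e # p"]) (auto intro: tree_nodes.child)
  qed
qed

theorem theorem3:
  fixes n :: nat
  shows "card (nodes_at_level n) = card (avoiding_inversion_seqs n {[0, 0, 0], [1, 0, 2]})"
proof (rule bij_betw_same_card)
  show "bij_betw seq_of_node (nodes_at_level n) (avoiding_inversion_seqs n {[0, 0, 0], [1, 0, 2]})"
    unfolding avoiding_inversion_seqs_000_102
  proof (rule bij_betw_imageI)
    show "inj_on seq_of_node (nodes_at_level n)"
      by (rule inj_on_subset[OF inj_on_seq_of_node]) (auto simp: nodes_at_level_def)
    \<comment> \<open>Level equals length, so the bijection on the whole tree restricts to each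
      level.\<close>
    show "seq_of_node ` nodes_at_level n = {xs. avoider xs \<and> length xs = n}"
    proof (intro subset_antisym subsetI)
      fix xs assume "xs \<in> {xs. avoider xs \<and> length xs = n}"
      moreover from this obtain p where "p \<in> tree_nodes" "xs = seq_of_node p"
        using seq_of_node_surj by blast
      ultimately show "xs \<in> seq_of_node ` nodes_at_level n"
        using seq_of_node_invariants(2) by (auto simp: nodes_at_level_def)
    qed (auto simp: nodes_at_level_def seq_of_node_invariants(1,2))
  qed
qed

end
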